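(* Let $G=(V,E)$ be a graph on $n$ vertices and let $\{S_1,S_2,S_3\}$ be a partition of $V$. Let $p\in\{1,-1,0\}^n$ be the vector with $p_i=1$ if $v_i\in S_1$, $p_i=-1$ if $v_i\in S_2$, and $p_i=0$ if $v_i\in S_3$. Then $p$ is an eigenvector of the signless Laplacian $Q=D+A$ of $G$ for the eigenvalue $q$ if and only if $$2d_{v_i}(S_1)+d_{v_i}(S_1,S_3)=q \text{ for all } v_i\in S_1,\qquad 2d_{v_i}(S_2)+d_{v_i}(S_2,S_3)=q \text{ for all } v_i\in S_2,$$ $$d_{v_i}(S_3,S_1)-d_{v_i}(S_3,S_2)=0 \text{ for all } v_i\in S_3.$$
   Context: Graphs are finite, simple and undirected with vertex set $V=\{v_1,\dots,v_n\}$; $A$ is the adjacency matrix and $D$ the diagonal matrix of vertex degrees. For $X\subseteq V$ and $v\in X$, $d_v(X)$ is the number of neighbours of $v$ in $X$; for disjoint $X,Y\subseteq V$ and $v\in X$, $d_v(X,Y)$ is the number of neighbours of $v$ in $Y$. *)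

theory Defs
  imports "Jordan_Normal_Form.Char_Poly" "HOL-Library.Disjoint_Sets"
begin

definition simple_graph :: "'a set \<Rightarrow> 'a set set \<Rightarrow> bool" where
  "simple_graph V E \<longleftrightarrow> finite V \<and> (\<forall>e\<in>E. e \<subseteq> V \<and> card e = 2)"

definition vertex_degree :: "'a set set \<Rightarrow> 'a \<Rightarrow> nat" where
  "vertex_degree E u = card {e \<in> E. u \<in> e}"

text \<open>
  The number of neighbours of \<open>u\<close> in \<open>Y\<close>. This is \<open>d\<^sub>u(X)\<close> for \<open>Y = X \<ni> u\<close>, and
  \<open>d\<^sub>u(X, Y)\<close> for \<open>u \<in> X\<close> with \<open>Y\<close> disjoint from \<open>X\<close>: the set \<open>X\<close> only records where
  \<open>u\<close> lies.
\<close>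
definition nbrs_in :: "'a set set \<Rightarrow> 'a \<Rightarrow> 'a set \<Rightarrow> nat" where
  "nbrs_in E u Y = card {w \<in> Y. {u, w} \<in> E}"

text \<open>
  The matrices are taken with respect to an enumeration \<open>v 0, \<dots>, v (n - 1)\<close> of the vertices.
\<close>
definition adjacency_matrix :: "nat \<Rightarrow> (nat \<Rightarrow> 'a) \<Rightarrow> 'a set set \<Rightarrow> real mat" where
  "adjacency_matrix n v E = mat n n (\<lambda>(i, j). if {v i, v j} \<in> E then 1 else 0)"

definition degree_matrix :: "nat \<Rightarrow> (nat \<Rightarrow> 'a) \<Rightarrow> 'a set set \<Rightarrow> real mat" where
  "degree_matrix n v E = mat n n (\<lambda>(i, j). if i = j then real (vertex_degree E (v i)) else 0)"

definition signless_laplacian :: "nat \<Rightarrow> (nat \<Rightarrow> 'a) \<Rightarrow> 'a set set \<Rightarrow> real mat" where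
  "signless_laplacian n v E = degree_matrix n v E + adjacency_matrix n v E"

end

theory Submission imports Defs "HOL-Library.Indicator_Function" begin

text \<open>Regard \<open>p\<close> as the function \<open>f\<close> on vertices that is 1 on
  \<open>S1\<close>, -1 on \<open>S2\<close> and 0 on \<open>S3\<close>. At a vertex u the signless
  Laplacian gives deg(u) f(u) plus the sum of f over the neighbours of u. Write d1, d2, d3 for the
  numbers of neighbours of u in the three parts. The degree is d1 + d2 + d3
  (\<open>vertex_degree_eq_nbrs_in\<close>, \<open>nbrs_in_Un_disjoint\<close>) and the neighbour
  sum is d1 - d2 (\<open>sum_nbrs_indicator\<close>). So the eigenvalue equation at u reads (d1 + d2
  + d3) f(u) + d1 - d2 = q f(u), and putting f(u) = 1, -1, 0 yields the three conditions. The
  passage from matrix rows to vertices is \<open>signless_laplacian_mult_vec_nth\<close>.\<close>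

lemma card_2_doubletonE:
  assumes "card e = 2" and "u \<in> e"
  obtains w where "e = {u, w}"
  using assms by (metis card_2_iff doubleton_eq_iff insertE singletonD)

text \<open>Degrees count incident edges, while the conditions of the theorem count neighbours. As
  every edge has exactly two elements, both in \<open>V\<close>, sending a neighbour w to the edge
  {u, w} is a bijection.\<close>

lemma vertex_degree_eq_nbrs_in:
  assumes "simple_graph V E"
  shows "vertex_degree E u = nbrs_in E u V"
proof -
  have "bij_betw (\<lambda>w. {u, w}) {w \<in> V. {u, w} \<in> E} {e \<in> E. u \<in> e}"
  proof (rule bij_betw_imageI)
    show "inj_on (\<lambda>w. {u, w}) {w \<in> V. {u, w} \<in> E}"
      by (auto simp: inj_on_def doubleton_eq_iff)
    show "(\<lambda>w. {u, w}) ` {w \<in> V. {u, w} \<in> E} = {e \<in> E. u \<in> e}"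
    proof (intro equalityI subsetI)
      fix e assume e: "e \<in> {e \<in> E. u \<in> e}"
      with assms have "e \<subseteq> V" "card e = 2" "u \<in> e"
        by (auto simp: simple_graph_def)
      then obtain w where "e = {u, w}" by (elim card_2_doubletonE)
      with e \<open>e \<subseteq> V\<close> show "e \<in> (\<lambda>w. {u, w}) ` {w \<in> V. {u, w} \<in> E}" by auto
    qed auto
  qed
  then show ?thesis
    by (simp add: vertex_degree_def nbrs_in_def bij_betw_same_card)
qed

lemma nbrs_in_Un_disjoint:
  assumes "finite X" "finite Y" "X \<inter> Y = {}"
  shows "nbrs_in E u (X \<union> Y) = nbrs_in E u X + nbrs_in E u Y"
proof -
  have "{w \<in> X \<union> Y. {u, w} \<in> E} = {w \<in> X. {u, w} \<in> E} \<union> {w \<in> Y. {u, w} \<in> E}" by auto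
  moreover have "{w \<in> X. {u, w} \<in> E} \<inter> {w \<in> Y. {u, w} \<in> E} = {}" using assms(3) by auto
  ultimately show ?thesis
    using assms(1,2) by (simp add: nbrs_in_def card_Un_disjoint)
qed

text \<open>Evaluates the adjacency part of the matrix on the indicator of one part; by linearity
  this covers a difference of two indicators.\<close>

lemma sum_nbrs_indicator:
  assumes "finite V" "X \<subseteq> V"
  shows "(\<Sum>w\<in>{w \<in> V. {u, w} \<in> E}. indicator X w) = real (nbrs_in E u X)"
proof -
  have "{w \<in> V. {u, w} \<in> E} \<inter> X = {w \<in> X. {u, w} \<in> E}" using assms(2) by auto
  then show ?thesis
    using assms(1) sum_mult_indicator[of "{w \<in> V. {u, w} \<in> E}" "\<lambda>_. 1 :: real" X]
    by (simp add: nbrs_in_def)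
qed

lemma signless_laplacian_carrier: "signless_laplacian n v E \<in> carrier_mat n n"
  by (simp add: signless_laplacian_def degree_matrix_def adjacency_matrix_def)

text \<open>Removes the enumeration: once the entries of \<open>p\<close> come from a function
  \<open>f\<close> on vertices, a row of the product depends only on the vertex \<open>v i\<close>.
  The diagonal matrix contributes a single term, and the adjacency sum over indices is reindexed
  along the bijection \<open>v\<close>.\<close>

lemma signless_laplacian_mult_vec_nth:
  assumes "bij_betw v {..<n} V" and "p \<in> carrier_vec n"
    and "\<And>i. i < n \<Longrightarrow> p $ i = f (v i)" and "i < n"
  shows "(signless_laplacian n v E *\<^sub>v p) $ i =
    real (vertex_degree E (v i)) * f (v i) + (\<Sum>w\<in>{w \<in> V. {v i, w} \<in> E}. f w)"
proof -
  have "finite V" using assms(1) bij_betw_finite by blast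
  have "(signless_laplacian n v E *\<^sub>v p) $ i =
      (\<Sum>j<n. ((if i = j then real (vertex_degree E (v i)) else 0) +
        (if {v i, v j} \<in> E then 1 else 0)) * f (v j))"
    using assms(2-4)
    by (auto simp: signless_laplacian_def degree_matrix_def adjacency_matrix_def scalar_prod_def
        atLeast0LessThan intro!: sum.cong)
  also have "\<dots> = (\<Sum>j<n. if i = j then real (vertex_degree E (v i)) * f (v j) else 0) +
      (\<Sum>j<n. if {v i, v j} \<in> E then f (v j) else 0)"
    unfolding sum.distrib[symmetric] by (intro sum.cong) (auto simp: distrib_right)
  also have "(\<Sum>j<n. if {v i, v j} \<in> E then f (v j) else 0) =
      (\<Sum>w\<in>V. if {v i, w} \<in> E then f w else 0)"
    by (rule sum.reindex_bij_betw[OF assms(1)])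
  also have "\<dots> = (\<Sum>w\<in>{w \<in> V. {v i, w} \<in> E}. f w)"
    using \<open>finite V\<close> by (simp add: sum.inter_filter)
  finally show ?thesis using assms(4) by simp
qed


theorem theorem2p6:
  fixes V :: "'a set" and E :: "'a set set" and n :: nat and v :: "nat \<Rightarrow> 'a"
    and S1 S2 S3 :: "'a set" and p :: "real vec" and q :: real
  assumes "simple_graph V E"
    and "bij_betw v {..<n} V"
    and "partition_on V {S1, S2, S3}" and "distinct [S1, S2, S3]"
    and "p \<in> carrier_vec n"
    and "\<And>i. i < n \<Longrightarrow> v i \<in> S1 \<Longrightarrow> p $ i = 1"
    and "\<And>i. i < n \<Longrightarrow> v i \<in> S2 \<Longrightarrow> p $ i = -1"
    and "\<And>i. i < n \<Longrightarrow> v i \<in> S3 \<Longrightarrow> p $ i = 0"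
  shows "eigenvector (signless_laplacian n v E) p q \<longleftrightarrow>
    (\<forall>u\<in>S1. 2 * real (nbrs_in E u S1) + real (nbrs_in E u S3) = q) \<and>
    (\<forall>u\<in>S2. 2 * real (nbrs_in E u S2) + real (nbrs_in E u S3) = q) \<and>
    (\<forall>u\<in>S3. real (nbrs_in E u S1) - real (nbrs_in E u S2) = 0)"
proof -
  \<comment> \<open>Blocks of a partition are nonempty, and different blocks are disjoint;
    distinctness of the three names turns the latter into pairwise disjointness.\<close>
  have V: "V = S1 \<union> S2 \<union> S3" and ne: "S1 \<noteq> {}"
    and disj: "S1 \<inter> S2 = {}" "S1 \<inter> S3 = {}" "S2 \<inter> S3 = {}"
    using assms(3,4) by (auto simp: partition_on_def disjoint_def)
  have fin: "finite V" using assms(1) by (simp add: simple_graph_def)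
  \<comment> \<open>Written as a difference of indicators so that neighbour sums split into the
    counts for \<open>S1\<close> and \<open>S2\<close>.\<close>
  define f :: "'a \<Rightarrow> real" where "f w = indicator S1 w - indicator S2 w" for w
  define Qf where
    "Qf u = real (vertex_degree E u) * f u + (\<Sum>w\<in>{w \<in> V. {u, w} \<in> E}. f w)" for u
  have f1: "f u = 1" if "u \<in> S1" for u using that disj by (auto simp: f_def indicator_def)
  have f2: "f u = -1" if "u \<in> S2" for u using that disj by (auto simp: f_def indicator_def)
  have f3: "f u = 0" if "u \<in> S3" for u using that disj by (auto simp: f_def indicator_def)
  have vV: "v ` {..<n} = V" using assms(2) by (simp add: bij_betw_def)
  have pf: "p $ i = f (v i)" if "i < n" for i
  proof -
    have "v i \<in> S1 \<union> S2 \<union> S3" using vV that unfolding V by blast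
    then show ?thesis using assms(6-8)[OF that] f1 f2 f3 by auto
  qed
  have deg: "real (vertex_degree E u) =
      real (nbrs_in E u S1) + real (nbrs_in E u S2) + real (nbrs_in E u S3)" for u
  proof -
    have "finite S1" "finite S2" "finite S3" using fin V by auto
    moreover have "(S1 \<union> S2) \<inter> S3 = {}" using disj by auto
    ultimately show ?thesis
      using disj(1) by (simp add: vertex_degree_eq_nbrs_in[OF assms(1)] V nbrs_in_Un_disjoint)
  qed
  have Qf: "Qf u = (real (nbrs_in E u S1) + real (nbrs_in E u S2) + real (nbrs_in E u S3)) * f u
      + (real (nbrs_in E u S1) - real (nbrs_in E u S2))" for u
  proof -
    have "S1 \<subseteq> V" "S2 \<subseteq> V" using V by auto
    then have "(\<Sum>w\<in>{w \<in> V. {u, w} \<in> E}. f w) = real (nbrs_in E u S1) - real (nbrs_in E u S2)"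
      by (simp add: f_def sum_subtractf sum_nbrs_indicator[OF fin])
    then show ?thesis by (simp add: Qf_def deg)
  qed
  \<comment> \<open>An eigenvector has to be nonzero; any vertex of the nonempty part
    \<open>S1\<close> supplies an entry 1.\<close>
  have "p \<noteq> 0\<^sub>v n"
  proof -
    obtain u where "u \<in> S1" using ne by auto
    then have "u \<in> v ` {..<n}" unfolding vV V by simp
    then obtain i where "i < n" "v i = u" by auto
    then have "p $ i = 1" using pf f1[OF \<open>u \<in> S1\<close>] by simp
    then show ?thesis using \<open>i < n\<close> by auto
  qed
  then have "eigenvector (signless_laplacian n v E) p q \<longleftrightarrow>
      signless_laplacian n v E *\<^sub>v p = q \<cdot>\<^sub>v p"
    using assms(5) signless_laplacian_carrier[of n v E] by (auto simp: eigenvector_def)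
  also have "\<dots> \<longleftrightarrow> (\<forall>i<n. (signless_laplacian n v E *\<^sub>v p) $ i = q * p $ i)"
    using assms(5) signless_laplacian_carrier[of n v E] by (auto simp: vec_eq_iff)
  also have "\<dots> \<longleftrightarrow> (\<forall>i<n. Qf (v i) = q * f (v i))"
    using signless_laplacian_mult_vec_nth[OF assms(2,5) pf] pf by (simp add: Qf_def)
  also have "\<dots> \<longleftrightarrow> (\<forall>u\<in>V. Qf u = q * f u)"
    unfolding vV[symmetric] by auto
  also have "\<dots> \<longleftrightarrow> (\<forall>u\<in>S1. Qf u = q * f u) \<and> (\<forall>u\<in>S2. Qf u = q * f u) \<and> (\<forall>u\<in>S3. Qf u = q * f u)"
    unfolding V by auto
  \<comment> \<open>With f(u) = 1 the neighbours in \<open>S2\<close> cancel: (d1 + d2 + d3) + d1 -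
    d2 = 2 d1 + d3.\<close>
  also have "(\<forall>u\<in>S1. Qf u = q * f u) \<longleftrightarrow>
      (\<forall>u\<in>S1. 2 * real (nbrs_in E u S1) + real (nbrs_in E u S3) = q)"
    by (intro ball_cong refl) (auto simp: Qf f1)
  \<comment> \<open>With f(u) = -1 the d1 terms cancel, leaving -2 d2 - d3 = -q.\<close>
  also have "(\<forall>u\<in>S2. Qf u = q * f u) \<longleftrightarrow>
      (\<forall>u\<in>S2. 2 * real (nbrs_in E u S2) + real (nbrs_in E u S3) = q)"
    by (intro ball_cong refl) (auto simp: Qf f2)
  \<comment> \<open>With f(u) = 0 both the degree term and q vanish, so only the neighbour sum d1 -
    d2 remains.\<close>
  also have "(\<forall>u\<in>S3. Qf u = q * f u) \<longleftrightarrow>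
      (\<forall>u\<in>S3. real (nbrs_in E u S1) - real (nbrs_in E u S2) = 0)"
    by (intro ball_cong refl) (auto simp: Qf f3)
  finally show ?thesis .
qed

end
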